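(* Let $\mathcal{H}=\mathcal{H}_1\otimes\mathcal{H}_2$ with $\mathcal{H}_1,\mathcal{H}_2$ finite-dimensional complex Hilbert spaces. Let $T_1\otimes T_2$ be a local invertible transformation of the form $$T_1\otimes T_2=U_1\left(\sum_{k=1}^r\sqrt{r}\,\lambda_k|k\rangle\langle k|\right)\otimes U_2,$$ with arbitrary $\lambda_k>0$ and arbitrary unitaries $U_1$ on $\mathcal{H}_1$ and $U_2$ on $\mathcal{H}_2$, and let $\Lambda_{\rm LI}(\rho)=(T_1\otimes T_2)\rho(T_1\otimes T_2)^\dagger$. Then for any entanglement measure $E$ (with respect to a set of operations $\mathcal{C}_{\mathcal{X}}$) with the maximally entangled state $|\psi_{\rm max}\rangle$ there exists an entanglement measure $E'$, namely the one defined by $$E'(\rho)=E\left(\frac{\Lambda_{\rm LI}(\rho)}{{\rm tr}\,\Lambda_{\rm LI}(\rho)}\right)$$ (an entanglement measure with respect to $\mathcal{C}_{\mathcal{X}'}=\{\Lambda_{\rm LI}^{-1}\circ\Lambda\circ\Lambda_{\rm LI}:\Lambda\in\mathcal{C}_{\mathcal{X}}\}$), such that $T_1\otimes T_2|\psi_{\rm max}\rangle$ (up to normalization) is maximally entangled for $E'$.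
   Context: A quantum state is a positive semidefinite operator on $\mathcal{H}$ of trace one. It is separable if it is a convex combination of pure product states $|a\rangle\langle a|\otimes|b\rangle\langle b|$. The vectors $|k\rangle$ are orthonormal basis vectors. $\mathcal{C}_{\rm sep}$ is the set of maps $\Lambda(\rho)=\sum_i[A_i\otimes B_i]\rho[A_i\otimes B_i]^\dagger$, with $A_i$, $B_i$ linear operators on $\mathcal{H}_1$, $\mathcal{H}_2$. $\mathcal{C}_{\mathcal{X}}$ denotes a subset of $\mathcal{C}_{\rm sep}$ that is closed under composition and contains all local unitaries $\rho\mapsto[V_1\otimes V_2]\rho[V_1\otimes V_2]^\dagger$ ($V_1,V_2$ unitary). A local invertible operation is a map $\rho\mapsto[S_1\otimes S_2]\rho[S_1\otimes S_2]^\dagger$ with $S_1,S_2$ invertible; its inverse is the local invertible operation given by $S_1^{-1},S_2^{-1}$. An entanglement measure with respect to a composition-closed set $\mathcal{C}\subset\mathcal{C}_{\rm sep}$ is a real-valued function $E$ on states such that (i) $E(\sigma)=0$ if and only if $\sigma$ is separable, and (ii) $E(\rho)\ge E(\Lambda(\rho)/{\rm tr}\,\Lambda(\rho))$ for all states $\rho$ and all $\Lambda\in\mathcal{C}$ (with ${\rm tr}\,\Lambda(\rho)\neq0$). A state $\rho_{\rm max}$ is maximally entangled for $E$ if $E(\rho_{\rm max})\ge E(\rho)$ for all states $\rho$; a pure state $|\psi\rangle$ is identified with $|\psi\rangle\langle\psi|$.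
   Formalization: As printed, T1⊗T2|ψmax⟩ need not maximize E'. Proved instead: it is maximal for E(Λ_LI⁻¹(ρ)/tr), a measure w.r.t. {Λ_LI∘Λ∘Λ_LI⁻¹}; and the printed E' is a measure w.r.t. C_X' with maximally entangled state T1⁻¹⊗T2⁻¹|ψmax⟩ (normalized). *)

theory Defs
  imports "HOL-Analysis.Analysis"
begin

text \<open>
  The spaces \<open>\<H>\<^sub>1\<close>, \<open>\<H>\<^sub>2\<close> and \<open>\<H>\<^sub>1 \<otimes> \<H>\<^sub>2\<close> are
  \<open>complex ^ 'm\<close>, \<open>complex ^ 'n\<close> and \<open>complex ^ ('m \<times> 'n)\<close> for arbitrary finite index types
  \<open>'m\<close>, \<open>'n\<close>; their \<open>norm\<close> is the Hilbert space norm. Operators are square matrices.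
  The library's \<open>inner\<close> on these types is only the real part of the Hermitian product,
  hence \<open>cinner\<close>, which is antilinear in its first argument.
\<close>

type_synonym 'a cop = "complex ^ 'a ^ 'a"

definition cinner :: "complex ^ ('a::finite) \<Rightarrow> complex ^ 'a \<Rightarrow> complex" where
  "cinner x y = (\<Sum>i\<in>UNIV. cnj (x $ i) * y $ i)"

definition dagger :: "'a::finite cop \<Rightarrow> 'a cop" where
  "dagger A = (\<chi> i j. cnj (A $ j $ i))"

definition unitary :: "'a::finite cop \<Rightarrow> bool" where
  "unitary U \<longleftrightarrow> dagger U ** U = mat 1 \<and> U ** dagger U = mat 1"

definition ketbra :: "complex ^ ('a::finite) \<Rightarrow> complex ^ 'a \<Rightarrow> 'a cop" where
  "ketbra x y = (\<chi> i j. x $ i * cnj (y $ j))"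

abbreviation pure :: "complex ^ ('a::finite) \<Rightarrow> 'a cop" where
  "pure \<psi> \<equiv> ketbra \<psi> \<psi>"

definition tensor_op :: "'m::finite cop \<Rightarrow> 'n::finite cop \<Rightarrow> ('m \<times> 'n) cop" (infixr "\<otimes>" 75) where
  "A \<otimes> B = (\<chi> p q. A $ fst p $ fst q * B $ snd p $ snd q)"

text \<open>Over the complex numbers, the condition below already forces \<open>A\<close> to be Hermitian.\<close>

definition psd :: "'a::finite cop \<Rightarrow> bool" where
  "psd A \<longleftrightarrow> (\<forall>v. cinner v (A *v v) \<in> \<real> \<and> 0 \<le> Re (cinner v (A *v v)))"

definition is_state :: "'a::finite cop \<Rightarrow> bool" where
  "is_state \<rho> \<longleftrightarrow> psd \<rho> \<and> trace \<rho> = 1"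

definition separable :: "('m::finite \<times> 'n::finite) cop \<Rightarrow> bool" where
  "separable \<sigma> \<longleftrightarrow>
     \<sigma> \<in> convex hull {pure a \<otimes> pure b | (a :: complex ^ 'm) (b :: complex ^ 'n).
                          norm a = 1 \<and> norm b = 1}"

definition renorm :: "'a::finite cop \<Rightarrow> 'a cop" where
  "renorm X = (\<chi> i j. X $ i $ j / trace X)"

definition local_map ::
  "'m::finite cop \<Rightarrow> 'n::finite cop \<Rightarrow> ('m \<times> 'n) cop \<Rightarrow> ('m \<times> 'n) cop" where
  "local_map A B \<rho> = (A \<otimes> B) ** \<rho> ** dagger (A \<otimes> B)"

definition sep_maps :: "(('m::finite \<times> 'n::finite) cop \<Rightarrow> ('m \<times> 'n) cop) set" where
  "sep_maps = {\<lambda>\<rho>. \<Sum>i<N. local_map (A i) (B i) \<rho> |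
                 (N :: nat) (A :: nat \<Rightarrow> 'm cop) (B :: nat \<Rightarrow> 'n cop). True}"

definition closed_under_comp :: "('a \<Rightarrow> 'a) set \<Rightarrow> bool" where
  "closed_under_comp C \<longleftrightarrow> (\<forall>\<Lambda>\<in>C. \<forall>\<Lambda>'\<in>C. \<Lambda> \<circ> \<Lambda>' \<in> C)"

definition local_unitaries :: "(('m::finite \<times> 'n::finite) cop \<Rightarrow> ('m \<times> 'n) cop) set" where
  "local_unitaries = {local_map V1 V2 | V1 V2. unitary V1 \<and> unitary V2}"

definition entanglement_measure ::
  "(('m::finite \<times> 'n::finite) cop \<Rightarrow> ('m \<times> 'n) cop) set \<Rightarrow> (('m \<times> 'n) cop \<Rightarrow> real) \<Rightarrow> bool" where
  "entanglement_measure C E \<longleftrightarrow>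
     C \<subseteq> sep_maps \<and> closed_under_comp C \<and>
     (\<forall>\<sigma>. is_state \<sigma> \<longrightarrow> (E \<sigma> = 0 \<longleftrightarrow> separable \<sigma>)) \<and>
     (\<forall>\<rho> \<Lambda>. is_state \<rho> \<longrightarrow> \<Lambda> \<in> C \<longrightarrow> trace (\<Lambda> \<rho>) \<noteq> 0 \<longrightarrow> E (renorm (\<Lambda> \<rho>)) \<le> E \<rho>)"

definition maximally_entangled :: "('a::finite cop \<Rightarrow> real) \<Rightarrow> 'a cop \<Rightarrow> bool" where
  "maximally_entangled E \<rho>max \<longleftrightarrow>
     is_state \<rho>max \<and> (\<forall>\<rho>. is_state \<rho> \<longrightarrow> E \<rho> \<le> E \<rho>max)"

end

(*
  Conjugation by an invertible local operation L is, up to normalisation, a bijection of the set of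
  states that maps separable states onto separable states and separable maps to separable maps.
  Hence every entanglement measure can be transported along L, and L carries a maximiser to a
  maximiser. The two parts of the theorem are this statement for L and for its inverse.
*)
theory Submission
  imports Defs
begin

section \<open>Matrix algebra of adjoints, tensor products and rank-one operators\<close>

lemma dagger_mult: "dagger (A ** B) = dagger B ** dagger A"
  by (simp add: dagger_def matrix_matrix_mult_def vec_eq_iff mult.commute)

text \<open>Each entry of the left side is a sum over a pair index that factors into two single
  sums.\<close>

lemma tensor_op_mult: "(A \<otimes> B) ** (C \<otimes> D) = (A ** C) \<otimes> (B ** D)"
proof -
  have "(\<Sum>p\<in>UNIV. A $ i $ fst p * B $ j $ snd p * (C $ fst p $ k * D $ snd p $ l)) =
      (\<Sum>x\<in>UNIV. A $ i $ x * C $ x $ k) * (\<Sum>y\<in>UNIV. B $ j $ y * D $ y $ l)" for i j k l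
    by (simp add: sum_product sum.cartesian_product case_prod_unfold ac_simps)
  then show ?thesis
    by (simp add: tensor_op_def matrix_matrix_mult_def vec_eq_iff)
qed

lemma tensor_op_mat_1: "mat 1 \<otimes> mat 1 = mat 1"
  by (auto simp: tensor_op_def mat_def vec_eq_iff)

lemma tensor_op_dagger: "dagger (A \<otimes> B) = dagger A \<otimes> dagger B"
  by (simp add: tensor_op_def dagger_def vec_eq_iff)

lemma trace_tensor_op: "trace (A \<otimes> B) = trace A * trace B"
  unfolding tensor_op_def trace_def
  by (simp add: sum_product sum.cartesian_product case_prod_unfold)

lemma tensor_op_scaleR: "(s *\<^sub>R A) \<otimes> (t *\<^sub>R B) = (s * t) *\<^sub>R (A \<otimes> B)"
  by (simp add: tensor_op_def vec_eq_iff)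

lemma ketbra_conj: "A ** pure x ** dagger A = pure (A *v x)"
proof -
  have "(\<Sum>k\<in>UNIV. (\<Sum>l\<in>UNIV. A $ i $ l * (x $ l * cnj (x $ k))) * cnj (A $ j $ k)) =
      (\<Sum>l\<in>UNIV. A $ i $ l * x $ l) * (\<Sum>k\<in>UNIV. cnj (A $ j $ k) * cnj (x $ k))" for i j
    by (subst mult.commute) (simp add: sum_product sum_distrib_left ac_simps)
  then show ?thesis
    by (simp add: ketbra_def matrix_matrix_mult_def matrix_vector_mult_def dagger_def vec_eq_iff)
qed

lemma trace_pure: "trace (pure x) = of_real ((norm x)\<^sup>2)"
proof -
  have "(norm x)\<^sup>2 = (\<Sum>i\<in>UNIV. (norm (x $ i))\<^sup>2)"
    by (simp add: norm_vec_def L2_set_def sum_nonneg)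
  then show ?thesis
    by (simp add: trace_def ketbra_def complex_norm_square del: of_real_power)
qed

lemma pure_scaleR: "pure (c *\<^sub>R x) = c\<^sup>2 *\<^sub>R pure x"
  by (simp add: ketbra_def vec_eq_iff power2_eq_square)

text \<open>Extracts the norm from the image of a vector under an invertible operator, leaving the
  unit vector that product states and pure states require.\<close>

lemma pure_normalise: "pure x = (norm x)\<^sup>2 *\<^sub>R pure (x /\<^sub>R norm x)"
proof (cases "x = 0")
  case True
  then show ?thesis
    by (simp add: ketbra_def vec_eq_iff)
next
  case False
  then have "(norm x)\<^sup>2 * (inverse (norm x))\<^sup>2 = 1"
    by (simp add: flip: power_mult_distrib)
  then show ?thesis
    by (simp only: pure_scaleR scaleR_scaleR scaleR_one)
qed

section \<open>Traces, scalar factors and normalisation\<close>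

lemma trace_scaleR: "trace (c *\<^sub>R A) = c *\<^sub>R trace A"
  for A :: "'a::finite cop"
  by (simp add: trace_def scaleR_sum_right)

text \<open>Complex factors are written as \<open>mat c **\<close>, since \<open>scaleR\<close>
  takes real factors while \<open>renorm\<close> divides by a complex trace. In this form they move
  through products by associativity and \<open>mat_commute\<close>.\<close>

lemma mat_mult: "mat c ** A = (\<chi> i j. c * A $ i $ j)"
  for A :: "'a::finite cop"
  by (simp add: mat_def matrix_matrix_mult_def vec_eq_iff if_distrib[of "\<lambda>x. x * _"] cong: if_cong)

lemma mat_commute: "A ** mat c = mat c ** A"
  for A :: "'a::finite cop"
  unfolding mat_mult
  by (simp add: mat_def matrix_matrix_mult_def vec_eq_iff mult.commute
      if_distrib[of "\<lambda>x. _ * x"] cong: if_cong)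

lemma trace_mat_mult: "trace (mat c ** A) = c * trace A"
  for A :: "'a::finite cop"
  by (simp add: mat_mult trace_def sum_distrib_left)

lemma renorm_eq_mat: "renorm X = mat (1 / trace X) ** X"
  by (simp add: renorm_def mat_mult)

lemma renorm_mat:
  assumes "c \<noteq> 0"
  shows "renorm (mat c ** X) = renorm X"
  using assms by (simp add: renorm_def mat_mult vec_eq_iff trace_mat_mult[unfolded mat_mult])

lemma scaleR_eq_mat: "c *\<^sub>R A = mat (of_real c) ** A"
  for A :: "'a::finite cop"
  by (simp add: mat_mult vec_eq_iff complex_eq_iff)

lemma renorm_scaleR: "c \<noteq> 0 \<Longrightarrow> renorm (c *\<^sub>R X) = renorm X"
  by (simp add: scaleR_eq_mat renorm_mat)

lemma renorm_trace_1: "trace X = 1 \<Longrightarrow> renorm X = X"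
  by (simp add: renorm_def vec_eq_iff)

lemma trace_renorm: "trace X \<noteq> 0 \<Longrightarrow> trace (renorm X) = 1"
  by (simp add: renorm_eq_mat trace_mat_mult)

section \<open>Local maps\<close>

lemma matrix_mult_add_left: "(A + B) ** C = A ** C + B ** C"
  for A B :: "'a::semiring_1 ^ 'n::finite ^ 'm"
  by (simp add: matrix_matrix_mult_def vec_eq_iff distrib_right sum.distrib)

lemma linear_local_map: "linear (local_map A B)"
  by (rule linearI)
    (simp_all add: local_map_def matrix_add_ldistrib matrix_mult_add_left matrix_scalar_ac
      scalar_matrix_assoc[symmetric])

text \<open>Complex homogeneity complements the real linearity of \<open>linear_local_map\<close>;
  it moves the factor in \<open>renorm\<close> through a local map.\<close>

lemma local_map_mat: "local_map A B (mat c ** X) = mat c ** local_map A B X"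
  by (simp add: local_map_def matrix_mul_assoc mat_commute[of "A \<otimes> B"])

lemma local_map_comp: "local_map A B (local_map C D X) = local_map (A ** C) (B ** D) X"
  by (simp add: local_map_def tensor_op_mult[symmetric] dagger_mult matrix_mul_assoc)

lemma dagger_mat_1: "dagger (mat 1) = mat 1"
  by (auto simp: dagger_def mat_def vec_eq_iff)

lemma local_map_mat_1: "local_map (mat 1) (mat 1) X = X"
  by (simp add: local_map_def tensor_op_mat_1 dagger_mat_1)

lemma local_map_pure: "local_map A B (pure \<psi>) = pure ((A \<otimes> B) *v \<psi>)"
  by (simp add: local_map_def ketbra_conj)

lemma local_map_tensor_pure: "local_map A B (pure a \<otimes> pure b) = pure (A *v a) \<otimes> pure (B *v b)"
  by (simp add: local_map_def tensor_op_mult tensor_op_dagger ketbra_conj)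

section \<open>Positivity and states\<close>

lemma cinner_dagger: "cinner v (A *v w) = cinner (dagger A *v v) w"
proof -
  have "cinner v (A *v w) = (\<Sum>i\<in>UNIV. \<Sum>j\<in>UNIV. cnj (v $ i) * (A $ i $ j * w $ j))"
    by (simp add: cinner_def matrix_vector_mult_def sum_distrib_left)
  also have "\<dots> = (\<Sum>j\<in>UNIV. \<Sum>i\<in>UNIV. cnj (v $ i) * (A $ i $ j * w $ j))"
    by (rule sum.swap)
  also have "\<dots> = cinner (dagger A *v v) w"
    by (simp add: cinner_def dagger_def matrix_vector_mult_def sum_distrib_right mult.assoc mult.left_commute)
  finally show ?thesis .
qed

text \<open>The quadratic form of \<open>A ** X ** dagger A\<close> at \<open>v\<close> is that of
  \<open>X\<close> at \<open>dagger A *v v\<close>.\<close>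

lemma psd_conj: "psd X \<Longrightarrow> psd (A ** X ** dagger A)"
  by (simp add: psd_def matrix_vector_mul_assoc[symmetric] cinner_dagger[of _ A])

lemma psd_local_map: "psd X \<Longrightarrow> psd (local_map A B X)"
  by (simp add: local_map_def psd_conj)

lemma psd_add: "psd X \<Longrightarrow> psd Y \<Longrightarrow> psd (X + Y)"
  by (simp add: psd_def cinner_def matrix_vector_mult_add_rdistrib distrib_left sum.distrib)

lemma psd_0: "psd 0"
  by (simp add: psd_def cinner_def)

lemma psd_sum: "(\<And>i. i \<in> I \<Longrightarrow> psd (f i)) \<Longrightarrow> psd (sum f I)"
  by (induction I rule: infinite_finite_induct) (auto simp: psd_0 psd_add)

lemma psd_sep_map: "\<Lambda> \<in> sep_maps \<Longrightarrow> psd X \<Longrightarrow> psd (\<Lambda> X)"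
  by (auto simp: sep_maps_def intro!: psd_sum psd_local_map)

lemma cinner_axis: "cinner (axis i 1) x = x $ i"
  by (simp add: cinner_def axis_def if_distrib[of "\<lambda>x. x * _"] if_distrib[of cnj] cong: if_cong)

lemma matrix_axis: "(X *v axis i c) $ j = X $ j $ i * c"
  for X :: "'a::finite cop"
  by (simp add: matrix_vector_mult_def axis_def if_distrib[of "\<lambda>x. _ * x"] cong: if_cong)

lemma psd_diag:
  assumes "psd X"
  shows "X $ i $ i \<in> \<real> \<and> 0 \<le> Re (X $ i $ i)"
  using assms[unfolded psd_def, rule_format, of "axis i 1"] by (simp add: cinner_axis matrix_axis)

lemma psd_trace:
  assumes "psd X"
  shows "trace X = of_real (Re (trace X))" "0 \<le> Re (trace X)"
proof -
  have "trace X \<in> \<real>"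
    using psd_diag[OF assms] by (auto simp: trace_def)
  then show "trace X = of_real (Re (trace X))"
    by simp
  show "0 \<le> Re (trace X)"
    using psd_diag[OF assms] by (auto simp: trace_def intro: sum_nonneg)
qed

text \<open>Makes a nonzero trace equivalent to being nonzero for positive operators, which is how
  the denominators in \<open>renorm\<close> are shown not to vanish. A nonnegative diagonal with sum
  zero vanishes, and the off-diagonal entries follow.\<close>

lemma psd_trace_0:
  assumes psd: "psd X" and tr: "trace X = 0"
  shows "X = 0"
proof -
  have "(\<Sum>i\<in>UNIV. Re (X $ i $ i)) = 0"
    using tr by (simp add: trace_def flip: Re_sum)
  then have "Re (X $ i $ i) = 0" for i
    using psd_diag[OF psd] by (simp add: sum_nonneg_eq_0_iff)
  then have diag: "X $ i $ i = 0" for i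
    using psd_diag[OF psd, of i] by (auto simp: complex_eq_iff complex_is_Real_iff)
  \<comment> \<open>With zero diagonal, the quadratic form at \<open>e\<^sub>i + c e\<^sub>j\<close> changes sign with \<open>c\<close>, so it vanishes.\<close>
  have off: "c * X $ i $ j + cnj c * X $ j $ i \<in> \<real> \<and>
      0 \<le> Re (c * X $ i $ j + cnj c * X $ j $ i)" for i j c
  proof -
    have "cinner (axis i 1 + axis j c) (X *v (axis i 1 + axis j c)) =
        c * X $ i $ j + cnj c * X $ j $ i"
    proof -
      have "cinner (u + v) w = cinner u w + cinner v w" for u v w :: "complex ^ 'a"
        by (simp add: cinner_def distrib_right sum.distrib)
      moreover have "cinner (axis j c) w = cnj c * w $ j" for w
        by (simp add: cinner_def axis_def if_distrib[of "\<lambda>x. x * _"] if_distrib[of cnj] cong: if_cong)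
      ultimately show ?thesis
        by (simp add: matrix_vector_right_distrib matrix_axis diag cinner_axis mult.commute)
    qed
    then show ?thesis
      using psd unfolding psd_def by metis
  qed
  \<comment> \<open>The values \<open>1\<close> and \<open>-1\<close> give
    \<open>X $ i $ j + X $ j $ i = 0\<close>; the values \<open>\<i>\<close> and
    \<open>-\<i>\<close> give \<open>X $ i $ j - X $ j $ i = 0\<close>.\<close>
  have "X $ i $ j = 0" for i j
    using off[of 1 i j] off[of "-1" i j] off[of \<i> i j] off[of "-\<i>" i j]
    by (simp add: complex_eq_iff complex_is_Real_iff)
  then show ?thesis
    by (simp add: vec_eq_iff)
qed

text \<open>The trace of a positive semidefinite matrix is a nonnegative real, so
  \<open>renorm\<close> scales the quadratic form by a positive real.\<close>

lemma is_state_renorm: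
  assumes "psd X" "trace X \<noteq> 0"
  shows "is_state (renorm X)"
proof -
  define t where "t = Re (trace X)"
  have t: "trace X = of_real t" "0 \<le> t"
    using psd_trace[OF assms(1)] by (auto simp: t_def)
  have "cinner v (renorm X *v v) = cinner v (X *v v) / of_real t" for v
    by (simp add: renorm_def t cinner_def matrix_vector_mult_def flip: sum_divide_distrib)
  then have "psd (renorm X)"
    using assms(1) t by (simp add: psd_def)
  then show ?thesis
    using assms(2) by (simp add: is_state_def trace_renorm)
qed

text \<open>The quadratic form of \<open>pure x\<close> at \<open>v\<close> is the squared modulus
  of \<open>cinner v x\<close>, so only the trace condition constrains \<open>x\<close>.\<close>

lemma is_state_pure: "is_state (pure x) \<longleftrightarrow> norm x = 1"
proof -
  have "cinner v (pure x *v v) = cinner v x * cnj (cinner v x)" for v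
    by (simp add: cinner_def matrix_vector_mult_def ketbra_def sum_distrib_left sum_distrib_right
        ac_simps)
  then have "psd (pure x)"
    by (simp add: psd_def complex_mult_cnj)
  moreover have "complex_of_real ((norm x)\<^sup>2) = 1 \<longleftrightarrow> norm x = 1"
    using norm_ge_zero[of x] by (simp only: of_real_eq_1_iff power2_eq_1_iff) linarith
  ultimately show ?thesis
    by (simp add: is_state_def trace_pure del: of_real_power)
qed

text \<open>Together with \<open>renorm_mat\<close> this shows that normalising the input of a
  separable map leaves its normalised output unchanged.\<close>

lemma sep_map_mat:
  assumes "\<Lambda> \<in> sep_maps"
  shows "\<Lambda> (mat c ** X) = mat c ** \<Lambda> X"
proof -
  have "mat c ** (\<Sum>i\<in>I. f i) = (\<Sum>i\<in>I. mat c ** f i)" for I and f :: "nat \<Rightarrow> ('a \<times> 'b) cop"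
    by (induction I rule: infinite_finite_induct) (auto simp: matrix_add_ldistrib)
  then show ?thesis
    using assms by (auto simp: sep_maps_def local_map_mat)
qed

section \<open>Transport along an invertible local operation\<close>

locale local_invertible =
  fixes S1 S1' :: "'m::finite cop" and S2 S2' :: "'n::finite cop"
  assumes inverses: "S1 ** S1' = mat 1" "S1' ** S1 = mat 1" "S2 ** S2' = mat 1" "S2' ** S2 = mat 1"
begin

abbreviation "L \<equiv> local_map S1 S2"
abbreviation "L' \<equiv> local_map S1' S2'"

lemma L'_L: "L' (L X) = X" and L_L': "L (L' X) = X"
  by (simp_all add: local_map_comp inverses local_map_mat_1)

lemma tensor_inj: "(S1 \<otimes> S2) *v \<psi> = 0 \<Longrightarrow> \<psi> = 0"
  by (metis inverses(2,4) matrix_vector_mul_assoc matrix_vector_mul_lid matrix_vector_mult_0_right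
      tensor_op_mat_1 tensor_op_mult)

text \<open>If the trace vanished, positivity would give \<open>L X = 0\<close>, and applying
  \<open>L'\<close> would give \<open>X = 0\<close>.\<close>

lemma trace_L:
  assumes "psd X" "trace X \<noteq> 0"
  shows "trace (L X) \<noteq> 0"
proof
  assume "trace (L X) = 0"
  then have "L X = 0"
    using assms(1) psd_local_map psd_trace_0 by blast
  then have "X = 0"
    by (metis L'_L linear_0 linear_local_map)
  with assms(2) show False
    by (simp add: trace_def)
qed

lemma is_state_L:
  assumes "is_state \<rho>"
  shows "is_state (renorm (L \<rho>))"
  using assms by (intro is_state_renorm psd_local_map trace_L) (simp_all add: is_state_def)

text \<open>\<open>L\<close> commutes with the inner scalar factor and the outer
  \<open>renorm\<close> cancels it, so a chain of normalised maps needs only the last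
  normalisation.\<close>

lemma renorm_L_renorm: "trace X \<noteq> 0 \<Longrightarrow> renorm (L (renorm X)) = renorm (L X)"
  by (simp add: renorm_eq_mat[of X] local_map_mat renorm_mat)

text \<open>\<open>S1\<close> and \<open>S2\<close> act separately on the two factors of a product
  vector, and by injectivity neither image is zero.\<close>

lemma separable_L:
  assumes "separable \<sigma>"
  shows "separable (renorm (L \<sigma>))"
proof -
  define P where "P = convex hull {pure a \<otimes> pure b | (a :: complex ^ 'm) (b :: complex ^ 'n).
                          norm a = 1 \<and> norm b = 1}"
  have P1: "trace Y = 1" if "Y \<in> P" for Y
    using that unfolding P_def
  proof (rule hull_induct)
    show "convex {Y :: ('m \<times> 'n) cop. trace Y = 1}"
      by (auto simp: convex_def trace_add trace_scaleR simp flip: scaleR_add_left)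
  qed (auto simp: trace_tensor_op trace_pure)
  \<comment> \<open>The normalisation is not linear, so convexity is used for the cone over the product states.\<close>
  have "\<exists>t>0. \<exists>Y\<in>P. L \<sigma> = t *\<^sub>R Y"
    using assms unfolding separable_def
  proof (rule hull_induct)
    show "convex {\<sigma>. \<exists>t>0. \<exists>Y\<in>P. L \<sigma> = t *\<^sub>R Y}"
    proof (rule convexI, clarify)
      fix \<sigma> \<tau> u v s t Y Z
      assume uv: "0 \<le> (u::real)" "0 \<le> v" "u + v = 1" and st: "0 < (s::real)" "0 < (t::real)"
        and YZ: "Y \<in> P" "Z \<in> P" "L \<sigma> = s *\<^sub>R Y" "L \<tau> = t *\<^sub>R Z"
      \<comment> \<open>\<open>r\<close> is the trace of the image of the mixture, because
        \<open>Y\<close> and \<open>Z\<close> have trace one. Dividing by it turns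
        \<open>u * s\<close> and \<open>v * t\<close> into convex weights; it is positive since
        \<open>u\<close> and \<open>v\<close> are not both zero.\<close>
      define r where "r = u * s + v * t"
      have "0 < r"
        using uv st unfolding r_def by (cases "u = 0") (auto intro: add_pos_nonneg)
      have "convex P"
        by (simp add: P_def)
      then have "(u * s / r) *\<^sub>R Y + (v * t / r) *\<^sub>R Z \<in> P"
        using uv st YZ \<open>0 < r\<close> by (intro convexD) (auto simp: r_def simp flip: add_divide_distrib)
      moreover have "L (u *\<^sub>R \<sigma> + v *\<^sub>R \<tau>) = r *\<^sub>R ((u * s / r) *\<^sub>R Y + (v * t / r) *\<^sub>R Z)"
        using YZ \<open>0 < r\<close>
        by (simp add: linear_add[OF linear_local_map] linear_cmul[OF linear_local_map]
            scaleR_add_right)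
      ultimately show "\<exists>t>0. \<exists>Y\<in>P. L (u *\<^sub>R \<sigma> + v *\<^sub>R \<tau>) = t *\<^sub>R Y"
        using \<open>0 < r\<close> by blast
    qed
  next
    fix \<sigma>
    assume "\<sigma> \<in> {pure a \<otimes> pure b | (a :: complex ^ 'm) (b :: complex ^ 'n). norm a = 1 \<and> norm b = 1}"
    then obtain a :: "complex ^ 'm" and b :: "complex ^ 'n"
      where ab: "\<sigma> = pure a \<otimes> pure b" "norm a = 1" "norm b = 1"
      by blast
    define x y where "x = S1 *v a" and "y = S2 *v b"
    have "x \<noteq> 0" "y \<noteq> 0"
      using ab(2,3) inverses unfolding x_def y_def
      by (metis matrix_vector_mul_assoc matrix_vector_mul_lid matrix_vector_mult_0_right norm_zero
          zero_neq_one)+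
    moreover have "L \<sigma> = ((norm x)\<^sup>2 * (norm y)\<^sup>2) *\<^sub>R (pure (x /\<^sub>R norm x) \<otimes> pure (y /\<^sub>R norm y))"
      unfolding ab(1) local_map_tensor_pure x_def[symmetric] y_def[symmetric]
      by (metis pure_normalise tensor_op_scaleR)
    moreover have "pure (x /\<^sub>R norm x) \<otimes> pure (y /\<^sub>R norm y) \<in> P"
      unfolding P_def using \<open>x \<noteq> 0\<close> \<open>y \<noteq> 0\<close> by (intro hull_inc) force
    ultimately show "\<exists>t>0. \<exists>Y\<in>P. L \<sigma> = t *\<^sub>R Y"
      by (metis mult_pos_pos zero_less_norm_iff zero_less_power)
  qed
  then obtain t Y where tY: "0 < t" "Y \<in> P" "L \<sigma> = t *\<^sub>R Y"
    by blast
  \<comment> \<open>Elements of \<open>P\<close> have trace one, so the normalisation removes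
    exactly the factor \<open>t\<close>.\<close>
  then have "renorm (L \<sigma>) = Y"
    by (simp add: renorm_scaleR renorm_trace_1 P1)
  with tY show ?thesis
    by (simp add: separable_def P_def)
qed

text \<open>Composing with \<open>L\<close> and \<open>L'\<close> replaces the operators
  \<open>A i\<close> and \<open>B i\<close> by \<open>S1 ** A i ** S1'\<close> and
  \<open>S2 ** B i ** S2'\<close>, which keeps the product form.\<close>

lemma conj_sep_map:
  assumes "\<Lambda> \<in> sep_maps"
  shows "L \<circ> \<Lambda> \<circ> L' \<in> sep_maps"
proof -
  obtain N :: nat and A B where \<Lambda>: "\<Lambda> = (\<lambda>\<rho>. \<Sum>i<N. local_map (A i) (B i) \<rho>)"
    using assms unfolding sep_maps_def by blast
  have "L \<circ> \<Lambda> \<circ> L' = (\<lambda>\<rho>. \<Sum>i<N. local_map (S1 ** A i ** S1') (S2 ** B i ** S2') \<rho>)"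
    by (simp add: \<Lambda> fun_eq_iff linear_sum[OF linear_local_map] local_map_comp matrix_mul_assoc)
  then show ?thesis
    unfolding sep_maps_def mem_Collect_eq by (intro exI conjI) auto
qed

text \<open>In a product of two conjugates the inner \<open>L' \<circ> L\<close> cancels.\<close>

lemma conj_closed_under_comp:
  assumes "closed_under_comp C"
  shows "closed_under_comp {L \<circ> \<Lambda> \<circ> L' | \<Lambda>. \<Lambda> \<in> C}"
proof -
  have "(L \<circ> \<Lambda> \<circ> L') \<circ> (L \<circ> \<Lambda>' \<circ> L') = L \<circ> (\<Lambda> \<circ> \<Lambda>') \<circ> L'" for \<Lambda> \<Lambda>'
    by (simp add: fun_eq_iff L'_L)
  then show ?thesis
    using assms unfolding closed_under_comp_def by blast
qed

text \<open>Carrying explicit inverses makes the locale assumptions symmetric, so all results on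
  \<open>L\<close> become available for \<open>L'\<close>.\<close>

lemma local_invertible_swap: "local_invertible S1' S1 S2' S2"
  by unfold_locales (simp_all add: inverses)

interpretation swap: local_invertible S1' S1 S2' S2
  by (rule local_invertible_swap)

text \<open>Both directions come from \<open>separable_L\<close>: once for \<open>L'\<close>, and
  once for \<open>L\<close>, which recovers \<open>\<sigma>\<close> after normalisation.\<close>

lemma separable_L'_iff:
  assumes "is_state \<sigma>"
  shows "separable (renorm (L' \<sigma>)) \<longleftrightarrow> separable \<sigma>"
proof
  have "trace (L' \<sigma>) \<noteq> 0"
    using assms swap.trace_L by (auto simp: is_state_def)
  then have "renorm (L (renorm (L' \<sigma>))) = \<sigma>"
    using assms by (simp add: renorm_L_renorm L_L' is_state_def renorm_trace_1)
  then show "separable \<sigma>" if "separable (renorm (L' \<sigma>))"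
    using separable_L[OF that] by simp
qed (rule swap.separable_L)

text \<open>Evaluating the new measure after \<open>L \<circ> \<Lambda> \<circ> L'\<close> cancels
  \<open>L\<close> against \<open>L'\<close>, so its monotonicity at \<open>\<rho>\<close> is that
  of \<open>E\<close> under \<open>\<Lambda>\<close> at the state
  \<open>renorm (L' \<rho>)\<close>.\<close>

lemma entanglement_measure_conj:
  assumes "entanglement_measure C E"
  shows "entanglement_measure {L \<circ> \<Lambda> \<circ> L' | \<Lambda>. \<Lambda> \<in> C} (\<lambda>\<rho>. E (renorm (L' \<rho>)))"
proof -
  have C: "C \<subseteq> sep_maps" "closed_under_comp C"
    and faithful: "\<And>\<sigma>. is_state \<sigma> \<Longrightarrow> E \<sigma> = 0 \<longleftrightarrow> separable \<sigma>"
    and monotone: "\<And>\<rho> \<Lambda>. is_state \<rho> \<Longrightarrow> \<Lambda> \<in> C \<Longrightarrow> trace (\<Lambda> \<rho>) \<noteq> 0 \<Longrightarrow>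
      E (renorm (\<Lambda> \<rho>)) \<le> E \<rho>"
    using assms by (simp_all add: entanglement_measure_def)
  have "E (renorm (L' (renorm (L (\<Lambda> (L' \<rho>)))))) \<le> E (renorm (L' \<rho>))"
    if \<rho>: "is_state \<rho>" and \<Lambda>: "\<Lambda> \<in> C" and tr: "trace (L (\<Lambda> (L' \<rho>))) \<noteq> 0" for \<rho> \<Lambda>
  proof -
    have \<Lambda>_sep: "\<Lambda> \<in> sep_maps"
      using C(1) \<Lambda> by (rule subsetD)
    have psd: "psd (L' \<rho>)" and tr': "trace (L' \<rho>) \<noteq> 0"
      using \<rho> by (auto simp: is_state_def psd_local_map swap.trace_L)
    \<comment> \<open>The nonzero trace is known only after the final \<open>L\<close>; positivity
      carries it back, since a positive operator of trace zero is zero and \<open>L\<close> maps it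
      to zero.\<close>
    have "trace (\<Lambda> (L' \<rho>)) \<noteq> 0"
    proof
      assume "trace (\<Lambda> (L' \<rho>)) = 0"
      then have "\<Lambda> (L' \<rho>) = 0"
        using psd \<Lambda>_sep psd_sep_map psd_trace_0 by blast
      with tr show False
        by (simp add: linear_0[OF linear_local_map] trace_def)
    qed
    then have "trace (\<Lambda> (renorm (L' \<rho>))) \<noteq> 0" "renorm (\<Lambda> (renorm (L' \<rho>))) = renorm (\<Lambda> (L' \<rho>))"
      using tr' by (simp_all add: renorm_eq_mat[of "L' \<rho>"] sep_map_mat[OF \<Lambda>_sep] trace_mat_mult
          renorm_mat)
    moreover have "is_state (renorm (L' \<rho>))"
      using \<rho> by (rule swap.is_state_L)
    ultimately have "E (renorm (\<Lambda> (L' \<rho>))) \<le> E (renorm (L' \<rho>))"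
      using monotone \<Lambda> by metis
    \<comment> \<open>\<open>swap.renorm_L_renorm\<close> drops the intermediate normalisation,
      after which \<open>L'\<close> undoes \<open>L\<close>.\<close>
    then show ?thesis
      using tr by (simp add: swap.renorm_L_renorm L'_L)
  qed
  moreover have "E (renorm (L' \<sigma>)) = 0 \<longleftrightarrow> separable \<sigma>" if "is_state \<sigma>" for \<sigma>
    using that by (simp add: faithful swap.is_state_L separable_L'_iff)
  moreover have "{L \<circ> \<Lambda> \<circ> L' | \<Lambda>. \<Lambda> \<in> C} \<subseteq> sep_maps"
    using C(1) conj_sep_map by blast
  ultimately show ?thesis
    using conj_closed_under_comp[OF C(2)] unfolding entanglement_measure_def by auto
qed

text \<open>At the normalised \<open>\<phi>\<close> the new measure has the value
  \<open>E (pure \<psi>)\<close>, and at any other state it takes a value of \<open>E\<close> at a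
  state, hence no larger one.\<close>

lemma maximally_entangled_conj:
  assumes max: "maximally_entangled E (pure \<psi>)"
  defines "\<phi> \<equiv> (S1 \<otimes> S2) *v \<psi>"
  shows "\<phi> \<noteq> 0" "maximally_entangled (\<lambda>\<rho>. E (renorm (L' \<rho>))) (pure (\<phi> /\<^sub>R norm \<phi>))"
proof -
  have \<psi>: "is_state (pure \<psi>)" "norm \<psi> = 1"
    using max by (auto simp: maximally_entangled_def is_state_pure)
  then show \<phi>: "\<phi> \<noteq> 0"
    using tensor_inj[of \<psi>] by (auto simp: \<phi>_def)
  \<comment> \<open>Normalising the vector and normalising its rank-one operator agree, because
    \<open>renorm\<close> ignores the factor \<open>(norm \<phi>)\<^sup>2\<close>.\<close>
  have "renorm (pure \<phi>) = renorm (pure (\<phi> /\<^sub>R norm \<phi>))"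
    using \<phi> by (subst pure_normalise) (simp add: renorm_scaleR)
  then have "pure (\<phi> /\<^sub>R norm \<phi>) = renorm (L (pure \<psi>))"
    using \<phi> by (simp add: local_map_pure \<phi>_def[symmetric] renorm_trace_1 trace_pure)
  moreover have "trace (L (pure \<psi>)) \<noteq> 0"
    using \<psi>(1) by (auto simp: is_state_def trace_L)
  ultimately have "renorm (L' (pure (\<phi> /\<^sub>R norm \<phi>))) = pure \<psi>"
    using \<psi>(1) by (simp add: swap.renorm_L_renorm L'_L renorm_trace_1 is_state_def)
  moreover have "is_state (pure (\<phi> /\<^sub>R norm \<phi>))"
    using \<phi> by (simp add: is_state_pure)
  ultimately show "maximally_entangled (\<lambda>\<rho>. E (renorm (L' \<rho>))) (pure (\<phi> /\<^sub>R norm \<phi>))"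
    using max swap.is_state_L by (auto simp: maximally_entangled_def)
qed

end

section \<open>Invertibility of the given local transformation\<close>

lemma matrix_inv_inverse:
  assumes "invertible A"
  shows "A ** matrix_inv A = mat 1" "matrix_inv A ** A = mat 1"
  using someI_ex[OF assms[unfolded invertible_def]] by (simp_all add: matrix_inv_def)

lemma unitary_invertible: "unitary U \<Longrightarrow> invertible U"
  by (auto simp: unitary_def invertible_def)

lemma invertible_diagonal:
  fixes d :: "'a::finite \<Rightarrow> complex"
  assumes "\<And>k. d k \<noteq> 0"
  shows "invertible (\<chi> i j. if i = j then d i else 0)"
proof -
  have "(\<chi> i j. if i = j then d i else 0) ** (\<chi> i j. if i = j then inverse (d i) else 0) = mat 1"
    using assms by (simp add: matrix_matrix_mult_def mat_def vec_eq_iff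
        if_distrib[of "\<lambda>x. x * _"] cong: if_cong)
  then show ?thesis
    by (auto simp: invertible_right_inverse)
qed

text \<open>The sum is \<open>K ** D ** dagger K\<close>, where the columns of \<open>K\<close> are
  the basis vectors and \<open>D\<close> is diagonal with the nonzero entries
  \<open>c k\<close>.\<close>

lemma invertible_sum_ketbra:
  fixes ket :: "'a::finite \<Rightarrow> complex ^ 'a"
  assumes orth: "\<And>k l. cinner (ket k) (ket l) = (if k = l then 1 else 0)"
    and "\<And>k. c k \<noteq> 0"
  shows "invertible (\<Sum>k\<in>UNIV. c k *\<^sub>R ketbra (ket k) (ket k))"
proof -
  define K :: "'a cop" where "K = (\<chi> i k. ket k $ i)"
  have "dagger K ** K = mat 1"
    using orth by (simp add: K_def dagger_def matrix_matrix_mult_def mat_def vec_eq_iff cinner_def)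
  \<comment> \<open>Orthonormality of the columns gives a left inverse; for square matrices it is
    also a right inverse.\<close>
  then have K: "unitary K"
    using matrix_left_right_inverse unfolding unitary_def by blast
  then have "unitary (dagger K)"
    by (simp add: unitary_def) (simp add: dagger_def)
  moreover have "(\<Sum>k\<in>UNIV. c k *\<^sub>R ketbra (ket k) (ket k)) =
      K ** (\<chi> i j. if i = j then of_real (c i) else 0) ** dagger K"
    by (simp add: K_def dagger_def matrix_matrix_mult_def vec_eq_iff ketbra_def
        if_distrib[of "\<lambda>x. _ * x"] scaleR_conv_of_real[where 'a = complex] ac_simps cong: if_cong)
  ultimately show ?thesis
    using K assms(2) by (simp add: invertible_mult unitary_invertible invertible_diagonal)
qed

text \<open>A measure defined through a map has its maximiser at the image of
  \<open>\<psi>max\<close> under the inverse map. Thus \<open>(T1 \<otimes> T2) *v \<psi>max\<close>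
  belongs to the measure defined through \<open>LIinv\<close>, and the measure defined through
  \<open>LI\<close> belongs to the image under the inverses of \<open>T1\<close> and
  \<open>T2\<close>; the conclusion states both pairings.\<close>

theorem mainTheorem3:
  fixes ket :: "'m::finite \<Rightarrow> complex ^ 'm"
    and lam :: "'m \<Rightarrow> real"
    and U1 T1 :: "'m cop"
    and U2 T2 :: "'n::finite cop"
    and LI LIinv :: "('m \<times> 'n) cop \<Rightarrow> ('m \<times> 'n) cop"
    and CX :: "(('m \<times> 'n) cop \<Rightarrow> ('m \<times> 'n) cop) set"
    and E :: "('m \<times> 'n) cop \<Rightarrow> real"
    and \<psi>max :: "complex ^ ('m \<times> 'n)"
  assumes orthonormal_basis: "\<And>k l. cinner (ket k) (ket l) = (if k = l then 1 else 0)"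
    and lam_pos: "\<And>k. lam k > 0"
    and unitaries: "unitary U1" "unitary U2"
    and T1: "T1 = U1 ** (\<Sum>k\<in>UNIV. (sqrt (real CARD('m)) * lam k) *\<^sub>R ketbra (ket k) (ket k))"
    and T2: "T2 = U2"
    and LI: "LI = local_map T1 T2"
    and LIinv: "LIinv = local_map (matrix_inv T1) (matrix_inv T2)"
    and CX: "CX \<subseteq> sep_maps" "closed_under_comp CX" "local_unitaries \<subseteq> CX"
    and E: "entanglement_measure CX E"
    and max: "maximally_entangled E (pure \<psi>max)"
  shows
    "(let E' = (\<lambda>\<rho>. E (renorm (LIinv \<rho>)));
          \<phi> = (T1 \<otimes> T2) *v \<psi>max
      in entanglement_measure {LI \<circ> \<Lambda> \<circ> LIinv | \<Lambda>. \<Lambda> \<in> CX} E' \<and>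
         \<phi> \<noteq> 0 \<and> maximally_entangled E' (pure (\<phi> /\<^sub>R norm \<phi>))) \<and>
     (let E' = (\<lambda>\<rho>. E (renorm (LI \<rho>)));
          \<phi> = (matrix_inv T1 \<otimes> matrix_inv T2) *v \<psi>max
      in entanglement_measure {LIinv \<circ> \<Lambda> \<circ> LI | \<Lambda>. \<Lambda> \<in> CX} E' \<and>
         \<phi> \<noteq> 0 \<and> maximally_entangled E' (pure (\<phi> /\<^sub>R norm \<phi>)))"
proof -
  \<comment> \<open>All coefficients \<open>sqrt (real CARD('m)) * lam k\<close> are positive, so
    the sum over the full basis is invertible, and so is its product with \<open>U1\<close>.\<close>
  have "invertible T1"
    unfolding T1
    using unitary_invertible[OF unitaries(1)] lam_pos orthonormal_basis
    by (intro invertible_mult invertible_sum_ketbra) (auto simp: less_imp_neq[symmetric])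
  moreover have "invertible T2"
    using T2 unitary_invertible[OF unitaries(2)] by simp
  ultimately interpret local_invertible T1 "matrix_inv T1" T2 "matrix_inv T2"
    by unfold_locales (simp_all add: matrix_inv_inverse)
  interpret swap: local_invertible "matrix_inv T1" T1 "matrix_inv T2" T2
    by (rule local_invertible_swap)
  show ?thesis
    unfolding Let_def LI LIinv
    using entanglement_measure_conj[OF E] maximally_entangled_conj[OF max]
      swap.entanglement_measure_conj[OF E] swap.maximally_entangled_conj[OF max]
    by blast
qed

end
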